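(* Let $\Gamma$ be the Sims-Gewirtz graph, i.e. the (unique) strongly regular graph with parameters $(56,10,0,2)$. Then $q(\Gamma)\neq 2$, and hence $q(\Gamma)=3$.
   Context: A graph $G$ is strongly regular with parameters $(n,k,\lambda,\mu)$ if it has $n$ vertices, is $k$-regular, any two adjacent vertices have exactly $\lambda$ common neighbors, and any two non-adjacent vertices have exactly $\mu$ common neighbors. For a graph $G$ on vertices $v_1,\dots,v_n$, $\mathcal S(G)$ is the set of real symmetric $n\times n$ matrices $A=[a_{ij}]$ such that for $i\neq j$, $a_{ij}\neq 0$ if and only if $v_i$ and $v_j$ are adjacent (diagonal entries are unrestricted). $q(G)$ is the minimum, over $A\in\mathcal S(G)$, of the number of distinct eigenvalues of $A$. *)

theory Defs
  imports "HOL-Analysis.Analysis"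
begin

definition simple_graph :: "('v \<Rightarrow> 'v \<Rightarrow> bool) \<Rightarrow> bool" where
  "simple_graph adj \<longleftrightarrow> symp adj \<and> irreflp adj"

definition nbrs :: "('v \<Rightarrow> 'v \<Rightarrow> bool) \<Rightarrow> 'v \<Rightarrow> 'v set" where
  "nbrs adj v = {w. adj v w}"

definition strongly_regular ::
    "('v::finite \<Rightarrow> 'v \<Rightarrow> bool) \<Rightarrow> nat \<Rightarrow> nat \<Rightarrow> nat \<Rightarrow> nat \<Rightarrow> bool" where
  "strongly_regular adj n k l m \<longleftrightarrow>
     simple_graph adj \<and>
     CARD('v) = n \<and>
     (\<forall>v. card (nbrs adj v) = k) \<and>
     (\<forall>v w. adj v w \<longrightarrow> card (nbrs adj v \<inter> nbrs adj w) = l) \<and>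
     (\<forall>v w. v \<noteq> w \<and> \<not> adj v w \<longrightarrow> card (nbrs adj v \<inter> nbrs adj w) = m)"

definition graph_matrices :: "('v::finite \<Rightarrow> 'v \<Rightarrow> bool) \<Rightarrow> (real ^ 'v ^ 'v) set" where
  "graph_matrices adj =
     {A. transpose A = A \<and> (\<forall>i j. i \<noteq> j \<longrightarrow> (A $ i $ j \<noteq> 0 \<longleftrightarrow> adj i j))}"

definition eigenvalues :: "real ^ 'v ^ 'v::finite \<Rightarrow> real set" where
  "eigenvalues A = {c. \<exists>x. x \<noteq> 0 \<and> A *v x = c *s x}"

text \<open>The minimum is attained: \<open>graph_matrices adj\<close> is nonempty for a simple graph (it contains
  the adjacency matrix). Sets of eigenvalues are finite, so \<open>card\<close> is a genuine count.\<close>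

definition q_graph :: "('v::finite \<Rightarrow> 'v \<Rightarrow> bool) \<Rightarrow> nat" where
  "q_graph adj = (LEAST d. \<exists>A \<in> graph_matrices adj. d = card (eigenvalues A))"

end

theory Submission
  imports Defs
begin

text \<open>Let \<open>A\<close> be a matrix of the graph with at most two distinct eigenvalues. Then \<open>A\<^sup>2\<close> is a
  combination of \<open>A\<close> and \<open>I\<close>, so for non-adjacent vertices the two products of entries along the
  two paths of length \<open>2\<close> cancel. Hence the matrix \<open>S\<close> of signs of the off-diagonal entries of \<open>A\<close>
  satisfies \<open>S\<^sup>2 = 10 I\<close> and \<open>(det S)\<^sup>2 = 10 ^ 56\<close>. On the other hand \<open>S\<close> is congruent modulo \<open>2\<close> to
  \<open>M = Adj - 2 I\<close>, where \<open>Adj\<close> is the adjacency matrix. As \<open>2\<close> is an eigenvalue of \<open>Adj\<close> of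
  multiplicity \<open>35\<close>, the rank of \<open>M\<close> is \<open>21\<close>, and expanding \<open>det (M + 2 E)\<close> along rows shows
  that \<open>2 ^ 35\<close> divides \<open>det S\<close>, a contradiction.\<close>

section \<open>Real symmetric matrices\<close>

lemma inner_symmetric_matrix:
  fixes A :: "real^'n^'n"
  assumes "transpose A = A"
  shows "(A *v x) \<bullet> y = x \<bullet> (A *v y)"
  by (metis assms dot_lmul_matrix transpose_matrix_vector)

text \<open>The quadratic form of \<open>A\<close> attains its maximum \<open>c\<close> on the unit
  sphere of \<open>W\<close> at some \<open>u\<close>. Its first variation there,
  \<open>A *v u - c *\<^sub>R u\<close>, is orthogonal to \<open>W\<close>; by invariance it also
  lies in \<open>W\<close>, so it vanishes.\<close>

lemma symmetric_eigenvector_in_subspace: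
  fixes A :: "real^'n^'n"
  assumes sym: "transpose A = A" and W: "subspace W" and inv: "\<And>x. x \<in> W \<Longrightarrow> A *v x \<in> W"
    and nz: "w \<in> W" "w \<noteq> 0"
  shows "\<exists>u c. u \<in> W \<and> u \<noteq> 0 \<and> A *v u = c *s u"
proof -
  let ?f = "\<lambda>x. x \<bullet> (A *v x)"
  have comp: "compact (sphere 0 1 \<inter> W)"
    by (intro compact_Int_closed closed_subspace W) auto
  have "(1 / norm w) *\<^sub>R w \<in> sphere 0 1 \<inter> W"
    using nz W by (simp add: subspace_scale)
  moreover have "continuous_on (sphere 0 1 \<inter> W) ?f"
    by (intro continuous_intros linear_continuous_on linear_conv_bounded_linear[THEN iffD1]
        matrix_vector_mul_linear)
  ultimately obtain u where u: "u \<in> sphere 0 1 \<inter> W"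
    and max: "\<And>x. x \<in> sphere 0 1 \<inter> W \<Longrightarrow> ?f x \<le> ?f u"
    using continuous_attains_sup[OF comp] by blast
  define c where "c = ?f u"
  have uu: "u \<bullet> u = 1" "u \<in> W" using u by (auto simp: dot_square_norm)
  have le: "?f x \<le> c * (x \<bullet> x)" if "x \<in> W" for x
  proof (cases "x = 0")
    case False
    let ?y = "(1 / norm x) *\<^sub>R x"
    have "?f ?y \<le> c"
      unfolding c_def using that False W by (intro max) (simp add: subspace_scale)
    moreover have "?f ?y = ?f x / (x \<bullet> x)"
      by (simp add: matrix_vector_mult_scaleR dot_square_norm power2_eq_square)
    moreover have "x \<bullet> x > 0" using False by simp
    ultimately show ?thesis by (simp add: pos_divide_le_eq del: inner_gt_zero_iff)
  qed simp
  have orth: "(A *v u - c *\<^sub>R u) \<bullet> y = 0" if y: "y \<in> W" for y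
  proof (rule ccontr)
    assume "(A *v u - c *\<^sub>R u) \<bullet> y \<noteq> 0"
    define b where "b = (A *v u - c *\<^sub>R u) \<bullet> y"
    define d where "d = c * (y \<bullet> y) - ?f y"
    have d: "d \<ge> 0" unfolding d_def using le[OF y] by simp
    \<comment> \<open>Maximality at \<open>u\<close> compared with \<open>u + t y\<close>: the term
      linear in \<open>t\<close> is bounded by the quadratic one for every \<open>t\<close>.\<close>
    have *: "2 * t * b \<le> t\<^sup>2 * d" for t :: real
    proof -
      have "u + t *\<^sub>R y \<in> W" using uu y W by (simp add: subspace_add subspace_scale)
      from le[OF this] have "c + t * (u \<bullet> (A *v y)) + t * (y \<bullet> (A *v u)) + t\<^sup>2 * ?f y
          \<le> c * (1 + 2 * t * (u \<bullet> y) + t\<^sup>2 * (y \<bullet> y))"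
        by (simp add: matrix_vector_right_distrib matrix_vector_mult_scaleR inner_add_left
            inner_add_right uu c_def inner_commute power2_eq_square algebra_simps)
      then show ?thesis
        using inner_symmetric_matrix[OF sym, of u y]
        by (simp add: b_def d_def inner_diff_left inner_commute algebra_simps)
    qed
    \<comment> \<open>A small \<open>t\<close> of the sign of \<open>b\<close> contradicts this. The
      choice is \<open>t = b / (d + 1)\<close>, with \<open>+ 1\<close> because \<open>d\<close> may
      be 0.\<close>
    have "2 * (1 / (d + 1)) * b\<^sup>2 \<le> (1 / (d + 1))\<^sup>2 * d * b\<^sup>2"
      using *[of "b / (d + 1)"] by (simp add: power2_eq_square ac_simps)
    then have "(d + 1)\<^sup>2 * (2 * (1 / (d + 1)) * b\<^sup>2) \<le> (d + 1)\<^sup>2 * ((1 / (d + 1))\<^sup>2 * d * b\<^sup>2)"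
      by (rule mult_left_mono) simp
    then have "(d + 2) * b\<^sup>2 \<le> 0"
      using d by (simp add: power2_eq_square) (simp add: algebra_simps)
    moreover have "b \<noteq> 0" unfolding b_def by fact
    ultimately show False using d by (simp add: mult_le_0_iff)
  qed
  have "A *v u - c *\<^sub>R u \<in> W" using uu inv W by (simp add: subspace_diff subspace_scale)
  from orth[OF this] have "A *v u = c *s u" by (simp add: scalar_mult_eq_scaleR)
  moreover have "u \<noteq> 0" using uu by auto
  ultimately show ?thesis using uu by blast
qed

text \<open>Eigenvectors chosen for distinct eigenvalues are nonzero and orthogonal, and a pairwise
  orthogonal set is finite.\<close>

lemma finite_eigenvalues_symmetric:
  fixes A :: "real^'n^'n"
  assumes sym: "transpose A = A"
  shows "finite (eigenvalues A)"
proof -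
  have "\<forall>c\<in>eigenvalues A. \<exists>x. x \<noteq> 0 \<and> A *v x = c *\<^sub>R x"
    by (auto simp: eigenvalues_def scalar_mult_eq_scaleR)
  from bchoice[OF this] obtain f
    where f: "\<forall>c\<in>eigenvalues A. f c \<noteq> 0 \<and> A *v f c = c *\<^sub>R f c" by blast
  have orth: "orthogonal (f c) (f d)" if "c \<in> eigenvalues A" "d \<in> eigenvalues A" "c \<noteq> d" for c d
  proof -
    have "c * (f c \<bullet> f d) = d * (f c \<bullet> f d)"
      using inner_symmetric_matrix[OF sym, of "f c" "f d"] f that by simp
    then show ?thesis using that by (simp add: orthogonal_def)
  qed
  have "inj_on f (eigenvalues A)"
    by (rule inj_onI) (metis orth f orthogonal_self)
  moreover have "finite (f ` eigenvalues A)"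
    by (rule pairwise_orthogonal_imp_finite) (auto simp: pairwise_def intro: orth)
  ultimately show ?thesis using finite_imageD by blast
qed

text \<open>The map \<open>C = (A - a)(A - b)\<close> is symmetric and commutes with
  \<open>A\<close>, so its range is invariant under \<open>A\<close>. If nonzero, the range contains
  an eigenvector of \<open>A\<close>, which \<open>C\<close> kills; but range and kernel of a
  symmetric map are orthogonal.\<close>

lemma symmetric_two_eigenvalues_quadratic:
  fixes A :: "real^'n^'n"
  assumes sym: "transpose A = A" and ev: "eigenvalues A \<subseteq> {a, b}"
  shows "A ** A = (a + b) *\<^sub>R A - (a * b) *\<^sub>R mat 1"
proof -
  define C where "C = (\<lambda>x. A *v (A *v x) - (a + b) *\<^sub>R (A *v x) + (a * b) *\<^sub>R x)"
  have lin: "linear C"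
    unfolding C_def by (intro linearI) (simp_all add: matrix_vector_right_distrib
        matrix_vector_mult_scaleR algebra_simps)
  have Csym: "C x \<bullet> y = x \<bullet> C y" for x y
    unfolding C_def by (simp add: inner_diff_left inner_add_left inner_diff_right inner_add_right
        inner_symmetric_matrix[OF sym])
  have C0: "C x = 0" for x
  proof (rule ccontr)
    assume "C x \<noteq> 0"
    have W: "subspace (range C)" using lin linear_subspace_image subspace_UNIV by blast
    have inv: "A *v y \<in> range C" if "y \<in> range C" for y
    proof -
      obtain z where "y = C z" using \<open>y \<in> range C\<close> by blast
      then have "A *v y = C (A *v z)"
        by (simp add: C_def matrix_vector_right_distrib matrix_vector_mult_diff_distrib
            matrix_vector_mult_scaleR)
      then show ?thesis by blast
    qed
    from symmetric_eigenvector_in_subspace[OF sym W inv rangeI \<open>C x \<noteq> 0\<close>]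
    obtain u c where u: "u \<in> range C" "u \<noteq> 0" "A *v u = c *s u" by blast
    then have "c = a \<or> c = b" using ev by (auto simp: eigenvalues_def)
    moreover have "C u = ((c - a) * (c - b)) *\<^sub>R u"
      using u(3) by (simp add: C_def scalar_mult_eq_scaleR matrix_vector_mult_scaleR algebra_simps)
    ultimately have "C u = 0" by auto
    moreover obtain z where "u = C z" using u(1) by blast
    ultimately have "u \<bullet> u = 0" using Csym[of z u] by simp
    then show False using u(2) by simp
  qed
  have "(A ** A) *v x = ((a + b) *\<^sub>R A - (a * b) *\<^sub>R mat 1) *v x" for x
    using C0[of x] by (simp add: C_def matrix_vector_mult_diff_rdistrib scaleR_matrix_vector_assoc
        [symmetric] matrix_vector_mul_assoc[symmetric] algebra_simps)
  then show ?thesis by (simp add: matrix_eq)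
qed

text \<open>Such a \<open>Q\<close> is an orthogonal projection, so its trace is its rank: with
  \<open>B\<close> an orthonormal basis of the range, \<open>Q\<close> is the sum of the matrices
  \<open>b b^T\<close>, each of trace 1.\<close>

lemma symmetric_idempotent_rows_in_span:
  fixes Q :: "real^'n^'n"
  assumes sym: "transpose Q = Q" and idem: "Q ** Q = Q"
  shows "\<exists>B. finite B \<and> real (card B) = trace Q \<and> (\<forall>i. Q $ i \<in> span B)"
proof -
  have "subspace (range (\<lambda>x. Q *v x))"
    by (intro linear_subspace_image matrix_vector_mul_linear subspace_UNIV)
  then obtain B where B: "B \<subseteq> range (\<lambda>x. Q *v x)" "pairwise orthogonal B"
      "\<And>x. x \<in> B \<Longrightarrow> norm x = 1" "independent B" "span B = range (\<lambda>x. Q *v x)"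
    using orthonormal_basis_subspace by metis
  have fin: "finite B" using B(4) independent_bound by blast
  have Qb: "Q *v b = b" if "b \<in> B" for b
    using that B(1) idem by (force simp: matrix_vector_mul_assoc)
  have row: "Q $ i = Q *v axis i 1" for i
    by (metis column_transpose matrix_vector_mult_basis row_def sym vec_lambda_eta)
  have exp: "Q $ i = (\<Sum>b\<in>B. b $ i *\<^sub>R b)" for i
  proof -
    have "Q *v axis i 1 = (\<Sum>b\<in>B. ((Q *v axis i 1) \<bullet> b) *\<^sub>R b)"
      by (rule orthonormal_basis_expand[symmetric]) (use B fin in auto)
    also have "\<dots> = (\<Sum>b\<in>B. b $ i *\<^sub>R b)"
      by (rule sum.cong) (simp_all add: inner_symmetric_matrix[OF sym] Qb inner_axis')
    finally show ?thesis by (simp add: row)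
  qed
  have "trace Q = (\<Sum>b\<in>B. \<Sum>i\<in>UNIV. b $ i * b $ i)"
    unfolding trace_def exp by (simp add: sum.swap[of _ B])
  also have "\<dots> = (\<Sum>b\<in>B. b \<bullet> b)"
    by (simp add: inner_vec_def)
  also have "\<dots> = real (card B)"
    using B(3) by (simp add: dot_square_norm)
  finally show ?thesis using fin B(5) row by auto
qed

section \<open>Divisibility of determinants\<close>

lemma det_Ints:
  fixes A :: "real^'n^'n"
  assumes "\<And>i j. A $ i $ j \<in> \<int>"
  shows "det A \<in> \<int>"
  unfolding det_def using assms by (intro Ints_sum Ints_mult Ints_prod) auto

lemma det_rows_in_small_span:
  fixes A :: "real^'n^'n"
  assumes fin: "finite B" and span: "\<And>i. i \<in> R \<Longrightarrow> A $ i \<in> span B" and card: "card B < card R"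
  shows "det A = 0"
\<comment> \<open>Coinciding rows collapse in the set of rows, which may then be too small for the
  dimension argument; they make the determinant vanish directly.\<close>
proof (cases "inj_on (($) A) R")
  case True
  have sub: "($) A ` R \<subseteq> rows A"
    by (auto simp: rows_def row_def)
  have "vec.dependent (($) A ` R)"
  proof (rule ccontr)
    assume "\<not> vec.dependent (($) A ` R)"
    moreover have "($) A ` R \<subseteq> vec.span B"
      using span by (auto simp: span_vec_eq)
    ultimately have "card (($) A ` R) \<le> card B"
      using vec.independent_span_bound[OF fin] by blast
    then show False using card True by (simp add: card_image)
  qed
  then show ?thesis using sub det_dependent_rows vec.dependent_mono by blast
next
  case False
  then obtain i j where "i \<noteq> j" "A $ i = A $ j" by (auto simp: inj_on_def)
  then show ?thesis by (intro det_identical_rows[of i j]) (auto simp: row_def)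
qed

text \<open>Expand the determinant along all rows. A term with the rows in \<open>T\<close> taken
  from \<open>c E\<close> carries \<open>c ^ card T\<close>, and it vanishes if more than
  \<open>card B\<close> rows come from \<open>M\<close>.\<close>

lemma det_low_rank_perturbation:
  fixes M E :: "real^'n^'n"
  assumes M: "\<And>i j. M $ i $ j \<in> \<int>" and E: "\<And>i j. E $ i $ j \<in> \<int>" and c: "c \<in> \<int>"
    and fin: "finite B" and span: "\<And>i. M $ i \<in> span B"
  shows "\<exists>k\<in>\<int>. det (M + c *\<^sub>R E) = c ^ (CARD('n) - card B) * k"
proof -
  let ?d = "CARD('n) - card B"
  \<comment> \<open>Rows in \<open>F\<close> are still to be expanded, rows in \<open>T\<close> are
    already taken from \<open>E\<close> with their factor \<open>c\<close> pulled out, and the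
    others are taken from \<open>M\<close>.\<close>
  let ?X = "\<lambda>F T. (\<chi> i. if i \<in> F then M $ i + c *s E $ i else if i \<in> T then E $ i else M $ i)
    :: real^'n^'n"
  have "\<exists>k\<in>\<int>. det (?X F T) = c ^ (?d - card T) * k" if "F \<inter> T = {}" for F T
    using finite[of F] that
  proof (induction F arbitrary: T rule: finite_induct)
    case empty
    have int: "det (?X {} T) \<in> \<int>" using M E by (intro det_Ints) auto
    show ?case
    proof (cases "card T < ?d")
      case True
      have "card (- T) = CARD('n) - card T" by (simp add: Compl_eq_Diff_UNIV card_Diff_subset)
      then have "card B < card (- T)" using True by simp
      then have "det (?X {} T) = 0"
        by (intro det_rows_in_small_span[OF fin, of "- T"]) (use span in auto)
      then show ?thesis by (intro bexI[of _ 0]) auto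
    next
      case False
      then show ?thesis using int by auto
    qed
  next
    case (insert p F)
    have T: "p \<notin> T" "F \<inter> T = {}" "F \<inter> insert p T = {}" using insert by auto
    obtain k where k: "k \<in> \<int>" "det (?X F T) = c ^ (?d - card T) * k"
      using insert.IH[OF T(2)] by blast
    obtain l where l: "l \<in> \<int>" "det (?X F (insert p T)) = c ^ (?d - Suc (card T)) * l"
      using insert.IH[OF T(3)] T(1) by auto
    let ?o = "\<lambda>i. ?X F T $ i"
    have "?X (insert p F) T = (\<chi> i. if i = p then M $ i + c *s E $ i else ?o i)"
      using insert.hyps T by (auto simp: vec_eq_iff)
    moreover have "?X F T = (\<chi> i. if i = p then M $ i else ?o i)"
      using insert.hyps T by (auto simp: vec_eq_iff)
    moreover have "?X F (insert p T) = (\<chi> i. if i = p then E $ i else ?o i)"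
      using insert.hyps T by (auto simp: vec_eq_iff)
    ultimately have "det (?X (insert p F) T) = det (?X F T) + c * det (?X F (insert p T))"
      by (simp only: det_row_add det_row_mul)
    also have "\<dots> = c ^ (?d - card T) * k + c ^ Suc (?d - Suc (card T)) * l"
      by (simp add: k l)
    also have "\<exists>m\<in>\<int>. \<dots> = c ^ (?d - card T) * m"
    proof (cases "card T < ?d")
      case True
      then have "Suc (?d - Suc (card T)) = ?d - card T" by simp
      then show ?thesis using k l by (intro bexI[of _ "k + l"]) (simp_all add: algebra_simps)
    \<comment> \<open>Here both truncated exponents are 0, and only integrality remains to be
      shown.\<close>
    next
      case False
      then show ?thesis using k l c by (intro bexI[of _ "k + c * l"]) simp_all
    qed
    finally show ?case .
  qed
  from this[of UNIV "{}"] show ?thesis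
    by (simp add: scalar_mult_eq_scaleR plus_vec_def scaleR_vec_def)
qed

section \<open>The Sims-Gewirtz graph\<close>

definition adjacency_matrix :: "('v::finite \<Rightarrow> 'v \<Rightarrow> bool) \<Rightarrow> real^'v^'v" where
  "adjacency_matrix adj = (\<chi> i j. of_bool (adj i j))"

locale gewirtz =
  fixes adj :: "'v::finite \<Rightarrow> 'v \<Rightarrow> bool"
  assumes srg: "strongly_regular adj 56 10 0 2"
begin

lemma card_vertices: "CARD('v) = 56"
  and adj_sym: "adj i j \<longleftrightarrow> adj j i"
  and adj_irrefl: "\<not> adj i i"
  and card_nbrs: "card (nbrs adj i) = 10"
  and common_nbrs_adj: "adj i j \<Longrightarrow> nbrs adj i \<inter> nbrs adj j = {}"
  and common_nbrs_nonadj: "i \<noteq> j \<Longrightarrow> \<not> adj i j \<Longrightarrow> card (nbrs adj i \<inter> nbrs adj j) = 2"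
  using srg unfolding strongly_regular_def simple_graph_def
  by (auto dest: sympD irreflpD simp: card_eq_0_iff)

lemma sum_adj: "(\<Sum>j\<in>UNIV. of_bool (adj i j)) = (10 :: real)"
  using card_nbrs[of i] by (simp add: nbrs_def)

text \<open>Entrywise, \<open>Adj^2 = 8 I - 2 Adj + 2 J\<close> with \<open>J\<close> the all-ones
  matrix: the common neighbour counts are 10 on the diagonal, 0 on edges and 2 elsewhere.\<close>

lemma sum_adj_adj:
  "(\<Sum>k\<in>UNIV. of_bool (adj i k) * of_bool (adj k j))
    = 8 * of_bool (i = j) - 2 * of_bool (adj i j) + (2 :: real)"
proof -
  have "(\<Sum>k\<in>UNIV. of_bool (adj i k) * of_bool (adj k j))
      = (\<Sum>k\<in>UNIV. of_bool (k \<in> nbrs adj i \<inter> nbrs adj j) :: real)"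
    by (intro sum.cong) (auto simp: nbrs_def adj_sym[of j])
  also have "\<dots> = real (card (nbrs adj i \<inter> nbrs adj j))"
    by (simp del: Int_iff)
  also have "\<dots> = 8 * of_bool (i = j) - 2 * of_bool (adj i j) + 2"
    using card_nbrs common_nbrs_adj common_nbrs_nonadj adj_irrefl
    by (cases "i = j"; cases "adj i j") auto
  finally show ?thesis .
qed

text \<open>The shift kills the eigenspace for 2. What remains is the 20-dimensional eigenspace for
  -4 and the line of constant vectors, with eigenvalue 10.\<close>

lemma adjacency_shift_rows_in_span:
  "\<exists>B. finite B \<and> card B \<le> 21 \<and> (\<forall>i. (adjacency_matrix adj - 2 *\<^sub>R mat 1) $ i \<in> span B)"
proof -
  \<comment> \<open>\<open>Q\<close> is the orthogonal projection onto the eigenspace of the adjacency matrix for \<open>-4\<close>.\<close>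
  define Q :: "real^'v^'v" where
    "Q = (\<chi> i j. of_bool (i = j) / 3 - of_bool (adj i j) / 6 + 1 / 42)"
  have "transpose Q = Q"
    by (auto simp: Q_def transpose_def vec_eq_iff adj_sym)
  moreover have "Q ** Q = Q"
  proof -
    have "(Q ** Q) $ i $ j = Q $ i $ j" for i j
    proof -
      \<comment> \<open>The product is expanded so that each sum over \<open>k\<close> is a
        Kronecker delta, a degree or a common neighbour count; \<open>adj j k\<close> is oriented to
        match \<open>sum_adj\<close>.\<close>
      have "(Q ** Q) $ i $ j = (\<Sum>k\<in>UNIV. of_bool (k = i) * Q $ k $ j / 3
          - of_bool (k = j) * of_bool (adj i k) / 18
          + of_bool (adj i k) * of_bool (adj k j) / 36 - of_bool (adj i k) / 252
          + of_bool (k = j) / 126 - of_bool (adj j k) / 252 + 1 / 1764)"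
        unfolding matrix_matrix_mult_def
        by (auto intro!: sum.cong simp: Q_def field_simps adj_sym)
      also have "\<dots> = Q $ i $ j / 3 - of_bool (adj i j) / 18
          + (8 * of_bool (i = j) - 2 * of_bool (adj i j) + 2) / 36 - 10 / 252
          + 1 / 126 - 10 / 252 + 56 / 1764"
        unfolding sum.distrib sum_subtractf sum_divide_distrib[symmetric] sum_adj sum_adj_adj
        by (simp add: card_vertices of_bool_def if_distrib[of "\<lambda>x. x * _"] cong: if_cong)
      also have "\<dots> = Q $ i $ j"
        by (simp add: Q_def field_simps)
      finally show ?thesis .
    qed
    then show ?thesis by (simp add: vec_eq_iff)
  qed
  moreover have "trace Q = 20"
    by (simp add: trace_def Q_def adj_irrefl card_vertices)
  ultimately obtain B where B: "finite B" "card B = 20" "\<And>i. Q $ i \<in> span B"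
    using symmetric_idempotent_rows_in_span[of Q] by auto
  \<comment> \<open>Spectral decomposition: \<open>Q\<close> has coefficient
    \<open>-4 - 2 = -6\<close>, and the projection \<open>J / 56\<close> onto the constants has
    coefficient \<open>10 - 2 = 8\<close>, giving \<open>1 / 7\<close>.\<close>
  have "(adjacency_matrix adj - 2 *\<^sub>R mat 1) $ i \<in> span (insert 1 B)" for i
  proof -
    have "(adjacency_matrix adj - 2 *\<^sub>R mat 1) $ i = (- 6) *\<^sub>R Q $ i + (1 / 7) *\<^sub>R 1"
      by (simp add: vec_eq_iff Q_def adjacency_matrix_def mat_def)
    also have "\<dots> \<in> span (insert 1 B)"
      using B(3) span_mono[of B "insert 1 B"]
      by (intro span_add span_scale) (auto intro: span_base)
    finally show ?thesis .
  qed
  then show ?thesis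
    using B by (intro exI[of _ "insert 1 B"]) (simp add: card_insert_if)
qed

text \<open>The exponent of 2 in \<open>(det S)^2\<close> would be exactly 56 by the equation, but
  at least 70 by the low rank modulo 2.\<close>

lemma no_signed_adjacency_square:
  fixes S :: "real^'v^'v"
  assumes S: "\<And>i j. S $ i $ j = (if adj i j then s i j else 0)"
    and s: "\<And>i j. s i j = 1 \<or> s i j = - 1"
  shows "S ** S \<noteq> 10 *\<^sub>R mat 1"
proof
  assume sq: "S ** S = 10 *\<^sub>R mat 1"
  have "det S * det S = 10 ^ 56"
    by (simp add: det_mul[symmetric] sq det_diagonal mat_def card_vertices)
  moreover have "\<exists>k\<in>\<int>. det S = 2 ^ 35 * k"
  proof -
    let ?M = "adjacency_matrix adj - 2 *\<^sub>R mat 1"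
    \<comment> \<open>\<open>E\<close> is half of \<open>S - ?M\<close>: 1 on the diagonal cancels
      the shift \<open>-2\<close>, and -1 on negative edges turns 1 into -1.\<close>
    let ?E = "(\<chi> i j. of_bool (i = j) - of_bool (adj i j \<and> s i j = - 1)) :: real^'v^'v"
    obtain B where B: "finite B" "card B \<le> 21" "\<And>i. ?M $ i \<in> span B"
      using adjacency_shift_rows_in_span by blast
    have "S = ?M + 2 *\<^sub>R ?E"
      using s adj_irrefl by (auto simp: vec_eq_iff S adjacency_matrix_def mat_def)
    moreover have "\<exists>k\<in>\<int>. det (?M + 2 *\<^sub>R ?E) = 2 ^ (CARD('v) - card B) * k"
      by (rule det_low_rank_perturbation)
        (use B in \<open>auto simp: adjacency_matrix_def mat_def\<close>)
    ultimately obtain k where k: "k \<in> \<int>" "det S = 2 ^ (56 - card B) * k"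
      by (auto simp: card_vertices)
    have "(2::real) ^ (56 - card B) = 2 ^ 35 * 2 ^ (21 - card B)"
      unfolding power_add[symmetric] using B(2) by (intro arg_cong[of _ _ "power 2"]) simp
    then show ?thesis using k by (intro bexI[of _ "2 ^ (21 - card B) * k"]) auto
  qed
  ultimately obtain k :: int where "(2 ^ 35 * of_int k) * (2 ^ 35 * of_int k) = (10 ^ 56 :: real)"
    by (auto elim!: Ints_cases)
  then have "of_int (2 ^ 35 * k * (2 ^ 35 * k)) = (of_int (10 ^ 56) :: real)" by simp
  then have "2 ^ 35 * k * (2 ^ 35 * k) = 10 ^ 56" by (simp only: of_int_eq_iff)
  \<comment> \<open>Cancelling \<open>2 ^ 56\<close> from
    \<open>2 ^ 70 * k^2 = 2 ^ 56 * 5 ^ 56\<close> leaves an even left side and an odd right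
    side.\<close>
  then have "2 ^ 14 * (k * k) = 5 ^ 56" by simp
  then have "even (5 ^ 56 :: int)" by (metis dvd_mult2 dvd_power zero_less_numeral)
  then show False by simp
qed

lemma card_eigenvalues_ge_3:
  assumes A: "A \<in> graph_matrices adj"
  shows "card (eigenvalues A) \<ge> 3"
proof (rule ccontr)
  assume "\<not> ?thesis"
  then have "card (eigenvalues A) \<le> 2" by simp
  have sym: "transpose A = A" and nz: "\<And>i j. i \<noteq> j \<Longrightarrow> A $ i $ j \<noteq> 0 \<longleftrightarrow> adj i j"
    using A by (auto simp: graph_matrices_def)
  have "\<exists>a b. eigenvalues A \<subseteq> {a, b}"
  proof -
    \<comment> \<open>Finiteness is what makes cardinality 0 mean an empty set of
      eigenvalues.\<close>
    have "card (eigenvalues A) = 0 \<or> card (eigenvalues A) = 1 \<or> card (eigenvalues A) = 2"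
      using \<open>card (eigenvalues A) \<le> 2\<close> by linarith
    then show ?thesis
      using finite_eigenvalues_symmetric[OF sym]
      by (auto simp: card_1_singleton_iff card_2_iff)
  qed
  then obtain a b where "eigenvalues A \<subseteq> {a, b}" by blast
  note quad = symmetric_two_eigenvalues_quadratic[OF sym this]
  \<comment> \<open>The value 1 at a zero entry keeps \<open>s\<close> equal to 1 or -1 off the
    edges too.\<close>
  define s where "s i j = (if A $ i $ j < 0 then - 1 else 1 :: real)" for i j
  define S :: "real^'v^'v" where "S = (\<chi> i j. if adj i j then s i j else 0)"
  have ssym: "s i j = s j i" for i j
    using arg_cong[OF sym, of "\<lambda>X. X $ i $ j"] by (simp add: s_def transpose_def)
  have SS: "(S ** S) $ i $ j = (\<Sum>k\<in>nbrs adj i \<inter> nbrs adj j. s i k * s k j)" for i j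
    unfolding matrix_matrix_mult_def S_def
    by (auto intro!: sum.mono_neutral_cong_right simp: nbrs_def adj_sym[of j]
        split: if_splits)
  have AA: "(\<Sum>k\<in>nbrs adj i \<inter> nbrs adj j. A $ i $ k * A $ k $ j) = 0"
    if "i \<noteq> j" "\<not> adj i j" for i j
  proof -
    have zero: "A $ i $ j = 0" using nz that by blast
    have "(A ** A) $ i $ j = 0"
      unfolding quad using zero that by (simp add: mat_def)
    \<comment> \<open>The terms \<open>k = i\<close> and \<open>k = j\<close> contain the factor
      \<open>A $ i $ j = 0\<close>, so the unrestricted diagonal of \<open>A\<close> does not
      contribute.\<close>
    moreover have "(A ** A) $ i $ j = (\<Sum>k\<in>nbrs adj i \<inter> nbrs adj j. A $ i $ k * A $ k $ j)"
      unfolding matrix_matrix_mult_def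
      using nz zero adj_sym by (auto intro!: sum.mono_neutral_right simp: nbrs_def) metis+
    ultimately show ?thesis by simp
  qed
  have "(S ** S) $ i $ j = (10 *\<^sub>R mat 1 :: real^'v^'v) $ i $ j" for i j
  proof -
    consider "i = j" | "adj i j" | "i \<noteq> j" "\<not> adj i j" by blast
    then show ?thesis
    proof cases
      case 1
      have "s i k * s k i = 1" for k using ssym[of i k] by (simp add: s_def)
      then show ?thesis using 1 card_nbrs[of i] by (simp add: SS mat_def)
    next
      case 2
      then show ?thesis using common_nbrs_adj[OF 2] adj_irrefl by (auto simp: SS mat_def)
    next
      case 3
      obtain x y where xy: "nbrs adj i \<inter> nbrs adj j = {x, y}" "x \<noteq> y"
        using common_nbrs_nonadj[OF 3] by (auto simp: card_2_iff)
      have "adj i x" "adj x j" "adj i y" "adj y j"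
        using xy(1) adj_sym by (auto simp: nbrs_def)
      then have "A $ i $ x \<noteq> 0" "A $ x $ j \<noteq> 0" "A $ i $ y \<noteq> 0" "A $ y $ j \<noteq> 0"
        using nz adj_irrefl by metis+
      moreover have "A $ i $ x * A $ x $ j = - (A $ i $ y * A $ y $ j)"
        using AA[OF 3] xy by simp
      \<comment> \<open>Two nonzero products with sum 0 have opposite signs, and signs are
        multiplicative.\<close>
      ultimately have "s i x * s x j + s i y * s y j = 0"
        unfolding s_def by (auto simp: not_less order_le_less)
          (smt (verit) mult_neg_neg mult_neg_pos mult_pos_neg mult_pos_pos)+
      then show ?thesis using xy 3 by (simp add: SS mat_def)
    qed
  qed
  then have "S ** S = 10 *\<^sub>R mat 1" by (simp add: vec_eq_iff)
  moreover have "S ** S \<noteq> 10 *\<^sub>R mat 1"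
    by (rule no_signed_adjacency_square[of S s]) (auto simp: S_def s_def)
  ultimately show False by blast
qed

section \<open>The upper bound: the spectrum of the adjacency matrix\<close>

lemma adjacency_matrix_in_graph_matrices: "adjacency_matrix adj \<in> graph_matrices adj"
  by (auto simp: graph_matrices_def adjacency_matrix_def transpose_def vec_eq_iff adj_sym)

text \<open>Let \<open>t\<close> be the coordinate sum of an eigenvector. Summing the eigenvalue
  equation gives \<open>c t = 10 t\<close>, and applying it twice gives
  \<open>(c - 2)(c + 4) x_i = 2 t\<close>. So \<open>c = 10\<close> unless \<open>t = 0\<close>, and
  then a nonzero coordinate forces \<open>c = 2\<close> or \<open>c = -4\<close>.\<close>

lemma eigenvalues_adjacency_matrix: "eigenvalues (adjacency_matrix adj) \<subseteq> {10, 2, - 4}"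
proof
  fix c assume "c \<in> eigenvalues (adjacency_matrix adj)"
  then obtain x where x: "x \<noteq> 0" "adjacency_matrix adj *v x = c *s x"
    by (auto simp: eigenvalues_def)
  have eq: "(\<Sum>j\<in>UNIV. of_bool (adj i j) * x $ j) = c * x $ i" for i
    using arg_cong[OF x(2), of "\<lambda>v. v $ i"]
    by (simp add: matrix_vector_mult_def adjacency_matrix_def)
  define t where "t = (\<Sum>i\<in>UNIV. x $ i)"
  have "c * t = (\<Sum>i\<in>UNIV. \<Sum>j\<in>UNIV. of_bool (adj i j) * x $ j)"
    unfolding eq t_def by (simp add: sum_distrib_left)
  also have "\<dots> = (\<Sum>j\<in>UNIV. (\<Sum>i\<in>UNIV. of_bool (adj j i)) * x $ j)"
    by (subst sum.swap) (simp only: sum_distrib_right adj_sym)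
  also have "\<dots> = 10 * t"
    unfolding sum_adj t_def by (simp add: sum_distrib_left)
  finally have ct: "c * t = 10 * t" .
  obtain i where i: "x $ i \<noteq> 0" using x(1) by (auto simp: vec_eq_iff)
  have "c * (c * x $ i) = (\<Sum>k\<in>UNIV. of_bool (adj i k) * (c * x $ k))"
    unfolding eq[symmetric, of i] by (simp only: sum_distrib_left mult.left_commute)
  also have "\<dots> = (\<Sum>j\<in>UNIV. (\<Sum>k\<in>UNIV. of_bool (adj i k) * of_bool (adj k j)) * x $ j)"
    unfolding eq[symmetric] sum_distrib_left sum_distrib_right
    by (subst sum.swap) (simp only: mult.assoc)
  also have "\<dots> = (\<Sum>j\<in>UNIV. 8 * (of_bool (j = i) * x $ j) - 2 * (of_bool (adj i j) * x $ j)
      + 2 * x $ j)"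
    unfolding sum_adj_adj by (intro sum.cong) (auto simp: algebra_simps)
  also have "\<dots> = 8 * x $ i - 2 * (c * x $ i) + 2 * t"
    unfolding sum.distrib sum_subtractf sum_distrib_left[symmetric] eq t_def
    by (simp add: of_bool_def if_distrib[of "\<lambda>z. z * _"] cong: if_cong)
  finally have "(c - 2) * (c + 4) * x $ i = 2 * t" by (simp add: algebra_simps)
  then show "c \<in> {10, 2, - 4}"
    using ct i by (cases "t = 0") auto
qed

lemma q_graph_eq_3: "q_graph adj = 3"
proof -
  have "card (eigenvalues (adjacency_matrix adj)) \<le> card {10, 2, - 4 :: real}"
    by (intro card_mono eigenvalues_adjacency_matrix) simp
  then have "card (eigenvalues (adjacency_matrix adj)) = 3"
    using card_eigenvalues_ge_3[OF adjacency_matrix_in_graph_matrices] by simp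
  then show ?thesis
    unfolding q_graph_def using adjacency_matrix_in_graph_matrices
    by (intro Least_equality) (force, use card_eigenvalues_ge_3 in blast)
qed

end

theorem theorem4p14:
  fixes adj :: "'v::finite \<Rightarrow> 'v \<Rightarrow> bool"
  assumes "strongly_regular adj 56 10 0 2"
  shows "q_graph adj \<noteq> 2 \<and> q_graph adj = 3"
  using gewirtz.q_graph_eq_3[OF gewirtz.intro[OF assms]] by simp

end
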